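(* Let $\xi_1,\xi_2\in[0,1]$ with $\xi_1+\xi_2\le 1$ be the predefined portions of vehicles choosing links $1$ and $2$, respectively, and let $\alpha_1,\alpha_2$ satisfy $\alpha_1+\alpha_2=1$, $\alpha_1\in[\xi_1,1-\xi_2]$, $\alpha_2\in[\xi_2,1-\xi_1]$. Consider the Riemann problem of the kinematic wave model of diverging traffic with one upstream link $0$ and two downstream links $1,2$, with initial states $U_0=(D_0,S_0)$ on link $0$ and $U_i=(D_i,S_i)$ on link $i$ ($i=1,2$). The boundary fluxes satisfying the entropy condition $$q_i=\min\left\{S_i(0^+,t),\ \frac{1}{\xi_j}S_j(0^+,t)-S_j(0^+,t),\ \max\{D_0(0^-,t)-S_j(0^+,t),\ \alpha_i D_0(0^-,t)\}\right\}\quad (i,j\in\{1,2\},\ i\ne j),$$ the traffic conservation equations, and the admissible conditions on stationary and interior states are given by $$q_i=\min\left\{S_i,\ \frac{1}{\xi_j}S_j-S_j,\ \max\{D_0-S_j,\ \alpha_i D_0\}\right\}\quad (i,j\in\{1,2\},\ i\neq j),$$ and $q_0=q_1+q_2$.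
   Context: Network and model. A diverge has one upstream link $0$ (coordinate $x_0\in(-\infty,0)$) and two downstream links $1,2$ (coordinates $x_i\in(0,\infty)$), meeting at $x=0$. A portion $\xi_i$ of the vehicles is predefined to choose link $i$ ($i=1,2$); the remaining portion $1-\xi_1-\xi_2$ can take either route. Each link $a$ is homogeneous with a unimodal flow-density relation $q=Q_a(\rho)=\rho V_a(\rho)$, critical density $\rho_{c,a}$, and capacity $C_a=Q_a(\rho_{c,a})>0$; total traffic on link $a$ obeys $\partial_t\rho+\partial_x Q_a(\rho)=0$. The Riemann problem has constant initial density on each link. Supply-demand space. Demand and supply on link $a$ are $D(\rho)=Q_a(\min\{\rho,\rho_{c,a}\})$ and $S(\rho)=Q_a(\max\{\rho,\rho_{c,a}\})$. A traffic state on link $a$ is represented as a pair $U=(D,S)$ with $0\le D,S\le C_a$ and $\max\{D,S\}=C_a$; its flow-rate is $q(U)=\min\{D,S\}$. A state is under-critical (UC) if $S=C_a$, over-critical (OC) if $D=C_a$, strictly under-critical (SUC) if $D<S=C_a$, strictly over-critical (SOC) if $S<D=C_a$. The initial states are $U_0=(D_0,S_0)$ and $U_i=(D_i,S_i)$. Unknowns (for $t>0$): stationary states $U_0^-=(D_0^-,S_0^-)$ on link $0$ and $U_i^+=(D_i^+,S_i^+)$ on link $i$; interior states at the junction $U_0(0^-,t)=(D_0(0^-,t),S_0(0^-,t))$ (a state on link $0$) and $U_i(0^+,t)=(D_i(0^+,t),S_i(0^+,t))$ (a state on link $i$), $i=1,2$. Boundary fluxes and traffic conservation: $q_0=q(U_0^-)$,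 $q_i=q(U_i^+)$, $q_0=q_1+q_2$. Admissible conditions for stationary states: $U_0^-=(D_0,C_0)$, or $U_0^-=(C_0,S_0^-)$ with $S_0^-<D_0$; and $U_i^+=(C_i,S_i)$, or $U_i^+=(D_i^+,C_i)$ with $D_i^+<S_i$. Admissible conditions for interior states: if $U_0^-$ is SOC then $U_0(0^-,t)=U_0^-$; if $U_0^-$ is UC then $U_0(0^-,t)$ is any state on link $0$ with $S_0(0^-,t)\ge D_0^-$; if $U_i^+$ is SUC then $U_i(0^+,t)=U_i^+$; if $U_i^+$ is OC then $U_i(0^+,t)$ is any state on link $i$ with $D_i(0^+,t)\ge S_i^+$. Convention: when $\xi_j=0$, the term containing $\frac{1}{\xi_j}$ is regarded as $+\infty$, i.e. it is omitted from the minimum. *)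

theory Defs
  imports Complex_Main
begin

text \<open>
  A homogeneous link is given by its speed-density relation \<open>V\<close> and its critical density; the
  flow-density relation is \<open>Q(\<rho>) = \<rho> V(\<rho>)\<close>. Densities range over \<open>[0, \<infinity>)\<close>; a link with a finite jam
  density is covered by taking \<open>V = 0\<close> beyond it. Unimodality is meant in the weak sense
  (\<open>Q\<close> nondecreasing up to the critical density, nonincreasing after it).
\<close>

record road_link =
  speed :: "real \<Rightarrow> real"
  crit_density :: real

definition flow :: "road_link \<Rightarrow> real \<Rightarrow> real" where
  "flow L \<rho> = \<rho> * speed L \<rho>"

definition capacity :: "road_link \<Rightarrow> real" where
  "capacity L = flow L (crit_density L)"

definition unimodal_link :: "road_link \<Rightarrow> bool" where
  "unimodal_link L \<longleftrightarrow>
     0 < crit_density L \<and> 0 < capacity L \<and>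
     (\<forall>\<rho>\<ge>0. 0 \<le> speed L \<rho>) \<and>
     (\<forall>\<rho> \<rho>'. 0 \<le> \<rho> \<longrightarrow> \<rho> \<le> \<rho>' \<longrightarrow> \<rho>' \<le> crit_density L \<longrightarrow> flow L \<rho> \<le> flow L \<rho>') \<and>
     (\<forall>\<rho> \<rho>'. crit_density L \<le> \<rho> \<longrightarrow> \<rho> \<le> \<rho>' \<longrightarrow> flow L \<rho>' \<le> flow L \<rho>)"

text \<open>Traffic states are pairs (demand, supply).\<close>

type_synonym state = "real \<times> real"

abbreviation demand_of :: "state \<Rightarrow> real" where "demand_of U \<equiv> fst U"
abbreviation supply_of :: "state \<Rightarrow> real" where "supply_of U \<equiv> snd U"

definition state_of_density :: "road_link \<Rightarrow> real \<Rightarrow> state" where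
  "state_of_density L \<rho> =
     (flow L (min \<rho> (crit_density L)), flow L (max \<rho> (crit_density L)))"

definition traffic_state :: "road_link \<Rightarrow> state \<Rightarrow> bool" where
  "traffic_state L U \<longleftrightarrow>
     0 \<le> demand_of U \<and> demand_of U \<le> capacity L \<and>
     0 \<le> supply_of U \<and> supply_of U \<le> capacity L \<and>
     max (demand_of U) (supply_of U) = capacity L"

lemma traffic_state_of_density:
  assumes "unimodal_link L" and "0 \<le> \<rho>"
  shows "traffic_state L (state_of_density L \<rho>)"
proof -
  have nonneg: "0 \<le> flow L r" if "0 \<le> r" for r
    using assms(1) that by (simp add: unimodal_link_def flow_def)
  show ?thesis
  proof (cases "\<rho> \<le> crit_density L")
    case True
    then show ?thesis
      using assms nonneg[of \<rho>]
      by (auto simp: traffic_state_def state_of_density_def capacity_def unimodal_link_def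
          min_absorb1 max_absorb2)
  next
    case False
    then show ?thesis
      using assms nonneg[of \<rho>]
      by (auto simp: traffic_state_def state_of_density_def capacity_def unimodal_link_def
          min_absorb2 max_absorb1)
  qed
qed

definition flow_rate :: "state \<Rightarrow> real" where
  "flow_rate U = min (demand_of U) (supply_of U)"

definition under_critical :: "road_link \<Rightarrow> state \<Rightarrow> bool" where
  "under_critical L U \<longleftrightarrow> supply_of U = capacity L"

definition over_critical :: "road_link \<Rightarrow> state \<Rightarrow> bool" where
  "over_critical L U \<longleftrightarrow> demand_of U = capacity L"

definition strictly_under_critical :: "road_link \<Rightarrow> state \<Rightarrow> bool" where
  "strictly_under_critical L U \<longleftrightarrow> demand_of U < supply_of U \<and> supply_of U = capacity L"

definition strictly_over_critical :: "road_link \<Rightarrow> state \<Rightarrow> bool" where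
  "strictly_over_critical L U \<longleftrightarrow> supply_of U < demand_of U \<and> demand_of U = capacity L"

text \<open>
  In the next four definitions \<open>U\<close> is the initial state, \<open>Us\<close> the stationary state and \<open>Ui\<close> the
  interior state (at some time) on the link.
\<close>

definition admissible_stationary_upstream :: "road_link \<Rightarrow> state \<Rightarrow> state \<Rightarrow> bool" where
  "admissible_stationary_upstream L U Us \<longleftrightarrow>
     Us = (demand_of U, capacity L) \<or> (\<exists>S. Us = (capacity L, S) \<and> S < demand_of U)"

definition admissible_stationary_downstream :: "road_link \<Rightarrow> state \<Rightarrow> state \<Rightarrow> bool" where
  "admissible_stationary_downstream L U Us \<longleftrightarrow>
     Us = (capacity L, supply_of U) \<or> (\<exists>D. Us = (D, capacity L) \<and> D < supply_of U)"

definition admissible_interior_upstream :: "road_link \<Rightarrow> state \<Rightarrow> state \<Rightarrow> bool" where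
  "admissible_interior_upstream L Us Ui \<longleftrightarrow>
     (strictly_over_critical L Us \<longrightarrow> Ui = Us) \<and>
     (under_critical L Us \<longrightarrow> demand_of Us \<le> supply_of Ui)"

definition admissible_interior_downstream :: "road_link \<Rightarrow> state \<Rightarrow> state \<Rightarrow> bool" where
  "admissible_interior_downstream L Us Ui \<longleftrightarrow>
     (strictly_under_critical L Us \<longrightarrow> Ui = Us) \<and>
     (over_critical L Us \<longrightarrow> supply_of Us \<le> demand_of Ui)"

text \<open>
  The flux into a downstream link \<open>i\<close>, where \<open>j\<close> is the other downstream link: \<open>D\<close> is the
  upstream demand and \<open>Si\<close>, \<open>Sj\<close> are the downstream supplies. If \<open>\<xi>\<^sub>j = 0\<close>, the term containing
  \<open>1 / \<xi>\<^sub>j\<close> counts as \<open>+\<infinity>\<close>; since \<open>1 / 0 = 0\<close> in HOL, it has to be dropped explicitly.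
\<close>

definition diverge_flux :: "real \<Rightarrow> real \<Rightarrow> real \<Rightarrow> real \<Rightarrow> real \<Rightarrow> real" where
  "diverge_flux \<xi>j \<alpha>i D Si Sj =
     (if \<xi>j = 0 then Min {Si, max (D - Sj) (\<alpha>i * D)}
      else Min {Si, 1 / \<xi>j * Sj - Sj, max (D - Sj) (\<alpha>i * D)})"

text \<open>
  Links are indexed by \<open>0\<close> (upstream) and \<open>1, 2\<close> (downstream); the values of the families at other
  indices are irrelevant. \<open>U\<close>, \<open>Us\<close>, \<open>Ui\<close>, \<open>q\<close> are the initial states, the stationary states, the
  interior states as functions of time, and the boundary fluxes.
\<close>

definition diverge_solution ::
  "(nat \<Rightarrow> road_link) \<Rightarrow> (nat \<Rightarrow> real) \<Rightarrow> (nat \<Rightarrow> real) \<Rightarrow> (nat \<Rightarrow> state) \<Rightarrow>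
   (nat \<Rightarrow> state) \<Rightarrow> (nat \<Rightarrow> real \<Rightarrow> state) \<Rightarrow> (nat \<Rightarrow> real) \<Rightarrow> bool" where
  "diverge_solution L \<xi> \<alpha> U Us Ui q \<longleftrightarrow>
     (\<forall>a\<in>{0,1,2}. traffic_state (L a) (Us a)) \<and>
     (\<forall>t>0. \<forall>a\<in>{0,1,2}. traffic_state (L a) (Ui a t)) \<and>
     (\<forall>a\<in>{0,1,2}. q a = flow_rate (Us a)) \<and>
     q 0 = q 1 + q 2 \<and>
     admissible_stationary_upstream (L 0) (U 0) (Us 0) \<and>
     (\<forall>i\<in>{1,2}. admissible_stationary_downstream (L i) (U i) (Us i)) \<and>
     (\<forall>t>0. admissible_interior_upstream (L 0) (Us 0) (Ui 0 t)) \<and>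
     (\<forall>t>0. \<forall>i\<in>{1,2}. admissible_interior_downstream (L i) (Us i) (Ui i t)) \<and>
     (\<forall>t>0. \<forall>i\<in>{1,2}. \<forall>j\<in>{1,2}. i \<noteq> j \<longrightarrow>
        q i = diverge_flux (\<xi> j) (\<alpha> i) (demand_of (Ui 0 t)) (supply_of (Ui i t)) (supply_of (Ui j t)))"

end

theory Submission
  imports Defs
begin

text \<open>
  For fixed demand \<open>D\<close> and supplies \<open>s\<^sub>1, s\<^sub>2\<close>, the two fluxes of the entropy condition are the
  solution of a small optimisation problem. Among the pairs \<open>(q\<^sub>1, q\<^sub>2)\<close> with \<open>q\<^sub>1 + q\<^sub>2 \<le> D\<close>,
  \<open>q\<^sub>i \<le> s\<^sub>i\<close> and \<open>\<xi>\<^sub>i (q\<^sub>1 + q\<^sub>2) \<le> q\<^sub>i\<close> (the vehicles bound for link \<open>i\<close> are at least the predefined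
  ones), they make the total flux as large as possible and then bring \<open>q\<^sub>1\<close> as close as possible to
  its preferred share \<open>\<alpha>\<^sub>1 (q\<^sub>1 + q\<^sub>2)\<close>. As for every convex problem, optimality can be read off
  locally: it depends on \<open>(D, s\<^sub>1, s\<^sub>2)\<close> only through which of the three bounds \<open>D, s\<^sub>1, s\<^sub>2\<close> are
  attained. Lemma \<open>fluxes_iff_optimal_split\<close> is this local characterisation, with \<open>route_saturated\<close>
  saying that the flux on a route cannot be improved. Making more bounds active preserves optimality,
  so the values of \<open>D, s\<^sub>1, s\<^sub>2\<close> may be replaced by any others that still admit \<open>q\<close> and that are
  attained wherever the old ones were (\<open>optimal_split_transfer\<close>).

  The admissible conditions say just this. Upstream, either \<open>q\<^sub>0 = D\<^sub>0\<close>, so the initial demand is an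
  active bound, or \<open>q\<^sub>0 < D\<^sub>0\<close> and the interior demand is the full capacity, an inactive bound;
  likewise for the supplies downstream. Hence every bound that is active in the interior is active
  initially, and a solution has the fluxes determined by the initial states. Conversely, given those
  fluxes, take the interior states equal to the stationary ones: this leaves the active bounds as
  they are and raises the inactive ones to the capacities, so the same fluxes satisfy the entropy
  condition.
\<close>

section \<open>The entropy condition as an optimal split of the upstream flow\<close>

text \<open>Clearing the denominator turns the convention for \<open>\<xi>\<^sub>j = 0\<close> into a guard on one inequality.\<close>

lemma diverge_flux_eq_iff:
  assumes "0 \<le> xj"
  shows "qi = diverge_flux xj ai D si sj \<longleftrightarrow>
    qi \<le> si \<and> (xj \<noteq> 0 \<longrightarrow> xj * qi \<le> (1 - xj) * sj) \<and> qi \<le> max (D - sj) (ai * D) \<and>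
    (qi = si \<or> (xj \<noteq> 0 \<and> xj * qi = (1 - xj) * sj) \<or> qi = max (D - sj) (ai * D))"
proof (cases "xj = 0")
  case True
  then show ?thesis by (auto simp: diverge_flux_def min_def)
next
  case False
  with assms have pos: "xj > 0" by simp
  then have le: "qi \<le> 1 / xj * sj - sj \<longleftrightarrow> xj * qi \<le> (1 - xj) * sj"
    and eq: "qi = 1 / xj * sj - sj \<longleftrightarrow> xj * qi = (1 - xj) * sj"
    by (simp_all add: field_simps)
  have "qi = Min {a, b, c} \<longleftrightarrow> qi \<le> a \<and> qi \<le> b \<and> qi \<le> c \<and> (qi = a \<or> qi = b \<or> qi = c)"
    for a b c :: real
    by (auto simp: min_def)
  with False show ?thesis by (simp add: diverge_flux_def flip: le eq)
qed

text \<open>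
  The flux \<open>qi\<close> on route \<open>i\<close> cannot be improved for one of three reasons: link \<open>i\<close> is full; link
  \<open>j\<close> is full and the vehicles bound for \<open>j\<close> block the queue, because nobody but they choose \<open>j\<close>;
  or the whole demand is served and route \<open>i\<close> has its preferred share, or more than that because
  link \<open>j\<close> is full. The second reason is meaningless when no vehicle is bound for \<open>j\<close>. Bounds occur
  only in equations, so the property is monotone in the set of active bounds.
\<close>

definition route_saturated ::
  "real \<Rightarrow> real \<Rightarrow> real \<Rightarrow> real \<Rightarrow> real \<Rightarrow> real \<Rightarrow> real \<Rightarrow> bool" where
  "route_saturated xj ai D si sj qi qj \<longleftrightarrow>
     qi = si \<or>
     (xj \<noteq> 0 \<and> qj = sj \<and> qj = xj * (qi + qj)) \<or>
     (qi + qj = D \<and>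
       (qi = ai * (qi + qj) \<or> (ai * (qi + qj) \<le> qi \<and> qj = sj)))"

definition feasible_split ::
  "real \<Rightarrow> real \<Rightarrow> real \<Rightarrow> real \<Rightarrow> real \<Rightarrow> real \<Rightarrow> real \<Rightarrow> bool" where
  "feasible_split xi xj D si sj qi qj \<longleftrightarrow>
     qi + qj \<le> D \<and> qi \<le> si \<and> qj \<le> sj \<and> 0 \<le> qi \<and> 0 \<le> qj \<and>
     xi * (qi + qj) \<le> qi \<and> xj * (qi + qj) \<le> qj"

definition optimal_split ::
  "real \<Rightarrow> real \<Rightarrow> real \<Rightarrow> real \<Rightarrow> real \<Rightarrow> real \<Rightarrow> real \<Rightarrow> real \<Rightarrow> real \<Rightarrow> bool" where
  "optimal_split xi xj ai aj D si sj qi qj \<longleftrightarrow>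
     feasible_split xi xj D si sj qi qj \<and>
     route_saturated xj ai D si sj qi qj \<and> route_saturated xi aj D sj si qj qi"

lemma route_saturated_transfer:
  assumes "route_saturated xj ai D si sj qi qj"
    and "qi + qj = D \<Longrightarrow> qi + qj = D'" "qi = si \<Longrightarrow> qi = si'" "qj = sj \<Longrightarrow> qj = sj'"
  shows "route_saturated xj ai D' si' sj' qi qj"
  using assms unfolding route_saturated_def by blast

lemma optimal_split_transfer:
  assumes "optimal_split xi xj ai aj D si sj qi qj"
    and "qi + qj \<le> D'" "qi \<le> si'" "qj \<le> sj'"
    and "qi + qj = D \<Longrightarrow> qi + qj = D'" "qi = si \<Longrightarrow> qi = si'" "qj = sj \<Longrightarrow> qj = sj'"
  shows "optimal_split xi xj ai aj D' si' sj' qi qj"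
proof -
  have "qj + qi = D \<Longrightarrow> qj + qi = D'" using assms(5) by (simp add: add.commute)
  then show ?thesis
    using assms(1-4) route_saturated_transfer[of xj ai D si sj qi qj, OF _ assms(5-7)]
      route_saturated_transfer[of xi aj D sj si qj qi, OF _ _ assms(7,6)]
    unfolding optimal_split_def feasible_split_def by blast
qed

text \<open>The facts below are stated for route \<open>i\<close>; exchanging \<open>i\<close> and \<open>j\<close> gives those for route \<open>j\<close>.\<close>

locale route_shares =
  fixes xi xj ai aj :: real
  assumes xi_nonneg: "0 \<le> xi" and xj_nonneg: "0 \<le> xj" and x_sum: "xi + xj \<le> 1"
    and a_sum: "ai + aj = 1" and xi_le: "xi \<le> ai" and xj_le: "xj \<le> aj"
begin

lemma swapped: "route_shares xj xi aj ai"
  using xi_nonneg xj_nonneg x_sum a_sum xi_le xj_le by unfold_locales auto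

lemma flux_nonneg:
  assumes "0 \<le> D" "0 \<le> si" "0 \<le> sj" "qi = diverge_flux xj ai D si sj"
  shows "0 \<le> qi"
proof -
  have ai: "0 \<le> ai * D" using xi_nonneg xi_le assms by simp
  have "0 \<le> (1 - xj) * sj" using xi_nonneg x_sum assms by simp
  then have "0 \<le> qi" if "xj \<noteq> 0" "xj * qi = (1 - xj) * sj"
    using that xj_nonneg by (metis less_eq_real_def mult_less_0_iff not_less)
  then show ?thesis using assms ai unfolding diverge_flux_eq_iff[OF xj_nonneg] by linarith
qed

text \<open>
  No vehicles are created. If \<open>qi\<close> exceeds its preferred share of the demand then it is at most
  \<open>D - sj\<close>, what link \<open>j\<close> cannot take; otherwise the roles are exchanged or both fluxes stay within
  their shares of \<open>D\<close>.
\<close>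

lemma flux_sum_le:
  assumes "qi = diverge_flux xj ai D si sj" "qj = diverge_flux xi aj D sj si"
  shows "qi + qj \<le> D"
proof -
  have "ai * D + aj * D = D" using a_sum by (metis distrib_right mult_1)
  then show ?thesis
    using assms unfolding diverge_flux_eq_iff[OF xj_nonneg] diverge_flux_eq_iff[OF xi_nonneg]
    by linarith
qed

text \<open>
  Route \<open>i\<close> gets at least its predefined portion. When link \<open>i\<close> is full this is the blocking
  bound on \<open>qj\<close>. Otherwise \<open>qi\<close> is at least its preferred share, or it is limited by the vehicles
  bound for \<open>j\<close>, and then route \<open>j\<close> gets no more than the portion \<open>xj \<le> 1 - xi\<close> of the total.
\<close>

lemma predefined_portion_le:
  assumes "0 \<le> D" "0 \<le> si" "0 \<le> sj"
    and "qi = diverge_flux xj ai D si sj" "qj = diverge_flux xi aj D sj si"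
  shows "xi * (qi + qj) \<le> qi"
proof -
  interpret swap: route_shares xj xi aj ai by (rule swapped)
  have q: "0 \<le> qi" "0 \<le> qj" "qi + qj \<le> D"
    using flux_nonneg[OF assms(1-4)] swap.flux_nonneg[OF assms(1,3,2,5)]
      flux_sum_le[OF assms(4,5)] by auto
  note fi = assms(4)[unfolded diverge_flux_eq_iff[OF xj_nonneg]]
  note fj = assms(5)[unfolded diverge_flux_eq_iff[OF xi_nonneg]]
  consider "qi = si" | "xj * qi = (1 - xj) * sj" | "ai * D \<le> qi"
    using fi by linarith
  then show ?thesis
  proof cases
    case 1
    then show ?thesis using fj q by (cases "xi = 0") (auto simp: algebra_simps)
  next
    case 2
    have "(1 - xj) * qj \<le> (1 - xj) * sj"
      using fj xi_nonneg x_sum by (intro mult_left_mono) auto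
    with 2 have "(1 - xj) * (qi + qj) \<le> qi" by (simp add: algebra_simps)
    moreover have "xi * (qi + qj) \<le> (1 - xj) * (qi + qj)"
      using q x_sum by (intro mult_right_mono) auto
    ultimately show ?thesis by linarith
  next
    case 3
    have "xi * (qi + qj) \<le> ai * D"
      using q xi_le xi_nonneg by (intro mult_mono) auto
    with 3 show ?thesis by linarith
  qed
qed

lemma feasible_split_fluxes:
  assumes "0 \<le> D" "0 \<le> si" "0 \<le> sj"
    and "qi = diverge_flux xj ai D si sj" "qj = diverge_flux xi aj D sj si"
  shows "feasible_split xi xj D si sj qi qj"
proof -
  interpret swap: route_shares xj xi aj ai by (rule swapped)
  have "qi \<le> si" "qj \<le> sj"
    using assms(4)[unfolded diverge_flux_eq_iff[OF xj_nonneg]]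
      assms(5)[unfolded diverge_flux_eq_iff[OF xi_nonneg]] by simp_all
  then show ?thesis
    using flux_nonneg[OF assms(1-4)] swap.flux_nonneg[OF assms(1,3,2,5)]
      flux_sum_le[OF assms(4,5)] predefined_portion_le[OF assms]
      swap.predefined_portion_le[OF assms(1,3,2,5,4)]
    by (simp add: feasible_split_def add.commute)
qed

text \<open>
  The cases are the terms at which the minima defining the two fluxes are attained. If neither link
  is full and neither flux is limited by blocking, then each is at least its share of \<open>D\<close>; since
  together they do not exceed \<open>D\<close>, both inequalities are equalities. If \<open>qi\<close> is at least its share
  and \<open>qj\<close> is limited by blocking, then \<open>qi\<close> is at most the portion \<open>xi \<le> ai\<close> of the total, and
  again everything is an equality. If \<open>qi\<close> itself is limited by blocking and \<open>xj < 1\<close>,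
  then link \<open>j\<close> is full, because route \<open>j\<close> gets at least its predefined portion.
\<close>

lemma route_saturated_fluxes:
  assumes "0 \<le> D" "0 \<le> si" "0 \<le> sj"
    and "qi = diverge_flux xj ai D si sj" "qj = diverge_flux xi aj D sj si"
  shows "route_saturated xj ai D si sj qi qj"
proof -
  note fi = assms(4)[unfolded diverge_flux_eq_iff[OF xj_nonneg]]
  note fj = assms(5)[unfolded diverge_flux_eq_iff[OF xi_nonneg]]
  have q: "0 \<le> qi" "0 \<le> qj" "qi + qj \<le> D" "qj \<le> sj" "qi \<le> si"
    and pi: "xi * (qi + qj) \<le> qi" and pj: "xj * (qi + qj) \<le> qj"
    using feasible_split_fluxes[OF assms] by (auto simp: feasible_split_def)
  have shares: "ai * D + aj * D = D" using a_sum by (metis distrib_right mult_1)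
  consider (full) "qi = si"
    | (blocked) "xj \<noteq> 0" "xj * qi = (1 - xj) * sj"
    | (served) "ai * D \<le> qi" "qi = max (D - sj) (ai * D)"
    using fi by linarith
  then show ?thesis
  proof cases
    case full
    then show ?thesis by (simp add: route_saturated_def)
  next
    case blocked
    show ?thesis
    proof (cases "xj = 1")
      case True
      \<comment> \<open>Every vehicle is bound for \<open>j\<close>: nothing flows to \<open>i\<close>, and \<open>qj\<close> is \<open>sj\<close> or \<open>D\<close>.\<close>
      then have zero: "xi = 0" "ai = 0" "aj = 1" "qi = 0"
        using x_sum xi_nonneg xi_le xj_le a_sum blocked by auto
      with fj have "qj = sj \<or> D \<le> qj" by auto
      then show ?thesis
      proof
        assume "qj = sj"
        with zero True show ?thesis by (simp add: route_saturated_def)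
      next
        assume "D \<le> qj"
        with zero q show ?thesis by (simp add: route_saturated_def)
      qed
    next
      case False
      have "(1 - xj) * sj \<le> (1 - xj) * qj" using blocked pj by (simp add: algebra_simps)
      then have "qj = sj" using False xi_nonneg x_sum q by auto
      moreover from this blocked have "qj = xj * (qi + qj)" by (simp add: algebra_simps)
      ultimately show ?thesis using blocked by (simp add: route_saturated_def)
    qed
  next
    case served
    consider "qj = sj" | "xi \<noteq> 0" "xi * qj = (1 - xi) * si" "qj < sj"
      | "aj * D \<le> qj"
      using fj by linarith
    then show ?thesis
    proof cases
      case 1
      then have "qi + qj = D" using served q by linarith
      with 1 served show ?thesis by (auto simp: route_saturated_def)
    next
      case 2
      have "(1 - xi) * qi \<le> (1 - xi) * si"
        using q xj_nonneg x_sum by (intro mult_left_mono) auto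
      with 2 have "qi \<le> xi * (qi + qj)" by (simp add: algebra_simps)
      also have "\<dots> \<le> ai * (qi + qj)" using xi_le q by (intro mult_right_mono) auto
      finally have le: "qi \<le> ai * (qi + qj)" .
      have "0 < ai" using 2 xi_nonneg xi_le by linarith
      then have "qi + qj = D" using served(1) le q
        by (metis mult_le_cancel_left_pos order.trans antisym)
      with le served(1) show ?thesis by (auto simp: route_saturated_def)
    next
      case 3
      then have "qi + qj = D" "qi = ai * D" using served(1) q shares by linarith+
      then show ?thesis by (simp add: route_saturated_def)
    qed
  qed
qed

text \<open>
  If \<open>qi\<close> exceeds its share of \<open>D\<close>, then \<open>qj\<close> is below its own share. Hence route \<open>j\<close> can only be
  saturated because link \<open>j\<close> is full, which gives the bound \<open>D - sj\<close>.
\<close>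

lemma optimal_split_le_served:
  assumes "optimal_split xi xj ai aj D si sj qi qj"
  shows "qi \<le> max (D - sj) (ai * D)"
proof (rule ccontr)
  assume "\<not> qi \<le> max (D - sj) (ai * D)"
  then have gt: "D - sj < qi" "ai * D < qi" by auto
  have q: "qi + qj \<le> D" "0 \<le> qi" "0 \<le> qj"
    and sat: "route_saturated xi aj D sj si qj qi"
    using assms by (auto simp: optimal_split_def feasible_split_def)
  have shares: "ai * D + aj * D = D" using a_sum by (metis distrib_right mult_1)
  have share: "xi * (qi + qj) \<le> ai * D"
    using q xi_le xi_nonneg by (intro mult_mono) auto
  from sat consider "qj = sj" | "qi = xi * (qi + qj)" | "qi + qj = D" "aj * D \<le> qj"
    unfolding route_saturated_def by (metis add.commute order_refl)
  then show False
  proof cases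
    case 1
    then show ?thesis using gt q by linarith
  next
    case 2
    then show ?thesis using share gt by linarith
  next
    case 3
    then show ?thesis using gt shares by linarith
  qed
qed

lemma flux_of_optimal_split:
  assumes opt: "optimal_split xi xj ai aj D si sj qi qj"
  shows "qi = diverge_flux xj ai D si sj"
proof -
  have q: "qi + qj \<le> D" "qi \<le> si" "qj \<le> sj" "xj * (qi + qj) \<le> qj"
    and sat: "route_saturated xj ai D si sj qi qj"
    using opt by (auto simp: optimal_split_def feasible_split_def)
  note served = optimal_split_le_served[OF opt]
  have "(1 - xj) * qj \<le> (1 - xj) * sj"
    using q xi_nonneg x_sum by (intro mult_left_mono) auto
  then have "xj * qi \<le> (1 - xj) * sj" using q by (simp add: algebra_simps)
  moreover have "qi = si \<or> (xj \<noteq> 0 \<and> xj * qi = (1 - xj) * sj) \<or> qi = max (D - sj) (ai * D)"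
    using sat unfolding route_saturated_def
  proof (elim disjE conjE)
    assume "qi + qj = D" "qi = ai * (qi + qj)"
    then show ?thesis using q by auto
  next
    assume "qi + qj = D" "ai * (qi + qj) \<le> qi" "qj = sj"
    then show ?thesis by auto
  qed (auto simp: algebra_simps)
  ultimately show ?thesis
    using q served by (simp add: diverge_flux_eq_iff[OF xj_nonneg])
qed

lemma fluxes_iff_optimal_split:
  assumes "0 \<le> D" "0 \<le> si" "0 \<le> sj"
  shows "qi = diverge_flux xj ai D si sj \<and> qj = diverge_flux xi aj D sj si \<longleftrightarrow>
    optimal_split xi xj ai aj D si sj qi qj"
proof -
  interpret swap: route_shares xj xi aj ai by (rule swapped)
  have sym: "optimal_split xj xi aj ai D sj si qj qi"
    if "optimal_split xi xj ai aj D si sj qi qj"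
    using that by (simp add: optimal_split_def feasible_split_def add.commute)
  show ?thesis
  proof (intro iffI; (elim conjE)?)
    assume q: "qi = diverge_flux xj ai D si sj" "qj = diverge_flux xi aj D sj si"
    show "optimal_split xi xj ai aj D si sj qi qj"
      using feasible_split_fluxes[OF assms q] route_saturated_fluxes[OF assms q]
        swap.route_saturated_fluxes[OF assms(1,3,2) q(2,1)]
      by (simp only: optimal_split_def simp_thms)
  next
    assume "optimal_split xi xj ai aj D si sj qi qj"
    then show "qi = diverge_flux xj ai D si sj \<and> qj = diverge_flux xi aj D sj si"
      by (intro conjI flux_of_optimal_split swap.flux_of_optimal_split[OF sym])
  qed
qed

end

section \<open>Admissible states as active and inactive bounds\<close>

text \<open>
  What the admissible conditions contribute: the boundary flux respects the initial bound, and the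
  interior bound is attained only if the initial one is. In the first alternative for the stationary
  state the initial bound is attained; in the second the interior state is the stationary one, whose
  bound is the capacity and hence strictly above the flux.
\<close>

lemma admissible_upstream_active:
  assumes "traffic_state L U"
    and "admissible_stationary_upstream L U Us" "admissible_interior_upstream L Us Ui"
  shows "flow_rate Us \<le> demand_of U"
    and "flow_rate Us = demand_of Ui \<Longrightarrow> flow_rate Us = demand_of U"
  using assms
  by (auto simp: traffic_state_def admissible_stationary_upstream_def flow_rate_def
      admissible_interior_upstream_def strictly_over_critical_def)

lemma admissible_downstream_active:
  assumes "traffic_state L U"
    and "admissible_stationary_downstream L U Us" "admissible_interior_downstream L Us Ui"
  shows "flow_rate Us \<le> supply_of U"
    and "flow_rate Us = supply_of Ui \<Longrightarrow> flow_rate Us = supply_of U"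
  using assms
  by (auto simp: traffic_state_def admissible_stationary_downstream_def flow_rate_def
      admissible_interior_downstream_def strictly_under_critical_def)

definition stationary_upstream :: "road_link \<Rightarrow> state \<Rightarrow> real \<Rightarrow> state" where
  "stationary_upstream L U q =
     (if q = demand_of U then (demand_of U, capacity L) else (capacity L, q))"

definition stationary_downstream :: "road_link \<Rightarrow> state \<Rightarrow> real \<Rightarrow> state" where
  "stationary_downstream L U q =
     (if q = supply_of U then (capacity L, supply_of U) else (q, capacity L))"

text \<open>Each stationary state may serve as its own interior state.\<close>

lemma stationary_upstream:
  assumes "traffic_state L U" "0 \<le> q" "q \<le> demand_of U"
  defines "Us \<equiv> stationary_upstream L U q"
  shows "traffic_state L Us" "flow_rate Us = q"
    "admissible_stationary_upstream L U Us" "admissible_interior_upstream L Us Us"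
    "q \<le> demand_of Us" "q = demand_of U \<Longrightarrow> q = demand_of Us"
  using assms
  by (auto simp: Us_def stationary_upstream_def traffic_state_def flow_rate_def
      admissible_stationary_upstream_def admissible_interior_upstream_def under_critical_def
      strictly_over_critical_def)

lemma stationary_downstream:
  assumes "traffic_state L U" "0 \<le> q" "q \<le> supply_of U"
  defines "Us \<equiv> stationary_downstream L U q"
  shows "traffic_state L Us" "flow_rate Us = q"
    "admissible_stationary_downstream L U Us" "admissible_interior_downstream L Us Us"
    "q \<le> supply_of Us" "q = supply_of U \<Longrightarrow> q = supply_of Us"
  using assms
  by (auto simp: Us_def stationary_downstream_def traffic_state_def flow_rate_def
      admissible_stationary_downstream_def admissible_interior_downstream_def over_critical_def
      strictly_under_critical_def)

section \<open>Fluxes at the diverge\<close>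

theorem theorem5p5:
  fixes L :: "nat \<Rightarrow> road_link" and \<xi> \<alpha> :: "nat \<Rightarrow> real"
    and U :: "nat \<Rightarrow> state" and q :: "nat \<Rightarrow> real"
  assumes links: "\<forall>a\<in>{0,1,2}. unimodal_link (L a)"
    and initial: "\<forall>a\<in>{0,1,2}. traffic_state (L a) (U a)"
    and xi: "\<xi> 1 \<in> {0..1}" "\<xi> 2 \<in> {0..1}" "\<xi> 1 + \<xi> 2 \<le> 1"
    and alpha: "\<alpha> 1 + \<alpha> 2 = 1" "\<alpha> 1 \<in> {\<xi> 1..1 - \<xi> 2}" "\<alpha> 2 \<in> {\<xi> 2..1 - \<xi> 1}"
  shows "(\<exists>Us Ui. diverge_solution L \<xi> \<alpha> U Us Ui q) \<longleftrightarrow>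
    (\<forall>i\<in>{1,2}. \<forall>j\<in>{1,2}. i \<noteq> j \<longrightarrow>
       q i = diverge_flux (\<xi> j) (\<alpha> i) (demand_of (U 0)) (supply_of (U i)) (supply_of (U j))) \<and>
    q 0 = q 1 + q 2"
proof -
  interpret route_shares "\<xi> 1" "\<xi> 2" "\<alpha> 1" "\<alpha> 2"
    using xi alpha by unfold_locales auto
  let ?opt = "\<lambda>V. optimal_split (\<xi> 1) (\<xi> 2) (\<alpha> 1) (\<alpha> 2)
    (demand_of (V 0)) (supply_of (V 1)) (supply_of (V 2)) (q 1) (q 2)"
  have fluxes: "(\<forall>i\<in>{1,2}. \<forall>j\<in>{1,2}. i \<noteq> j \<longrightarrow>
      q i = diverge_flux (\<xi> j) (\<alpha> i) (demand_of (V 0)) (supply_of (V i)) (supply_of (V j)))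
      \<longleftrightarrow> ?opt V" if "\<forall>a\<in>{0,1,2}. traffic_state (L a) (V a)" for V :: "nat \<Rightarrow> state"
  proof -
    have "0 \<le> demand_of (V 0)" "0 \<le> supply_of (V 1)" "0 \<le> supply_of (V 2)"
      using that by (auto simp: traffic_state_def)
    from fluxes_iff_optimal_split[OF this, of "q 1" "q 2"] show ?thesis by auto
  qed
  have init: "traffic_state (L 0) (U 0)" "traffic_state (L 1) (U 1)" "traffic_state (L 2) (U 2)"
    using initial by auto
  show ?thesis
  proof
    assume "\<exists>Us Ui. diverge_solution L \<xi> \<alpha> U Us Ui q"
    then obtain Us Ui where sol: "diverge_solution L \<xi> \<alpha> U Us Ui q" by blast
    \<comment> \<open>The interior states at a single time suffice.\<close>
    let ?V = "\<lambda>a. Ui a 1"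
    have sum: "q 0 = q 1 + q 2"
      and rate: "q 0 = flow_rate (Us 0)" "q 1 = flow_rate (Us 1)" "q 2 = flow_rate (Us 2)"
      using sol by (auto simp: diverge_solution_def)
    have states: "\<forall>a\<in>{0,1,2}. traffic_state (L a) (?V a)"
      using sol by (simp add: diverge_solution_def)
    have "\<forall>i\<in>{1,2}. \<forall>j\<in>{1,2}. i \<noteq> j \<longrightarrow>
      q i = diverge_flux (\<xi> j) (\<alpha> i) (demand_of (?V 0)) (supply_of (?V i)) (supply_of (?V j))"
      using sol zero_less_one unfolding diverge_solution_def by blast
    then have opt: "?opt ?V" by (rule iffD1[OF fluxes[of ?V, OF states]])
    have adm0: "admissible_stationary_upstream (L 0) (U 0) (Us 0)"
        "admissible_interior_upstream (L 0) (Us 0) (?V 0)"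
      and adm1: "admissible_stationary_downstream (L 1) (U 1) (Us 1)"
        "admissible_interior_downstream (L 1) (Us 1) (?V 1)"
      and adm2: "admissible_stationary_downstream (L 2) (U 2) (Us 2)"
        "admissible_interior_downstream (L 2) (Us 2) (?V 2)"
      using sol by (simp_all add: diverge_solution_def)
    note up = admissible_upstream_active[OF init(1) adm0, folded rate, unfolded sum]
    note down1 = admissible_downstream_active[OF init(2) adm1, folded rate]
    note down2 = admissible_downstream_active[OF init(3) adm2, folded rate]
    have "?opt U"
      by (rule optimal_split_transfer[OF opt up(1) down1(1) down2(1) up(2) down1(2) down2(2)])
    from conjI[OF iffD2[OF fluxes[OF initial] this] sum]
    show "(\<forall>i\<in>{1,2}. \<forall>j\<in>{1,2}. i \<noteq> j \<longrightarrow>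
       q i = diverge_flux (\<xi> j) (\<alpha> i) (demand_of (U 0)) (supply_of (U i)) (supply_of (U j))) \<and>
       q 0 = q 1 + q 2" .
  next
    assume rhs: "(\<forall>i\<in>{1,2}. \<forall>j\<in>{1,2}. i \<noteq> j \<longrightarrow>
       q i = diverge_flux (\<xi> j) (\<alpha> i) (demand_of (U 0)) (supply_of (U i)) (supply_of (U j))) \<and>
       q 0 = q 1 + q 2"
    then have sum: "q 0 = q 1 + q 2" by (rule conjunct2)
    have opt: "?opt U" by (rule iffD1[OF fluxes[OF initial] conjunct1[OF rhs]])
    from opt sum have q: "0 \<le> q 0" "0 \<le> q 1" "0 \<le> q 2"
      "q 0 \<le> demand_of (U 0)" "q 1 \<le> supply_of (U 1)" "q 2 \<le> supply_of (U 2)"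
      by (auto simp: optimal_split_def feasible_split_def)
    define Us where "Us a = (if a = 0 then stationary_upstream (L a) (U a) (q a)
      else stationary_downstream (L a) (U a) (q a))" for a :: nat
    have Us: "Us 0 = stationary_upstream (L 0) (U 0) (q 0)"
      "Us 1 = stationary_downstream (L 1) (U 1) (q 1)"
      "Us 2 = stationary_downstream (L 2) (U 2) (q 2)"
      by (simp_all add: Us_def)
    note s0 = stationary_upstream[OF init(1) q(1,4), folded Us]
    note s1 = stationary_downstream[OF init(2) q(2,5), folded Us]
    note s2 = stationary_downstream[OF init(3) q(3,6), folded Us]
    note bound0 = s0(5,6)[unfolded sum]
    have states: "\<forall>a\<in>{0,1,2}. traffic_state (L a) (Us a)"
      using s0(1) s1(1) s2(1) by simp
    have "?opt Us"
      by (rule optimal_split_transfer[OF opt bound0(1) s1(5) s2(5) bound0(2) s1(6) s2(6)])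
    then have entropy: "\<forall>i\<in>{1,2}. \<forall>j\<in>{1,2}. i \<noteq> j \<longrightarrow>
       q i = diverge_flux (\<xi> j) (\<alpha> i) (demand_of (Us 0)) (supply_of (Us i)) (supply_of (Us j))"
      by (rule iffD2[OF fluxes[OF states]])
    have "\<forall>a\<in>{0,1,2}. q a = flow_rate (Us a)"
      using s0(2) s1(2) s2(2) by simp
    moreover have "admissible_stationary_upstream (L 0) (U 0) (Us 0)"
      "admissible_interior_upstream (L 0) (Us 0) (Us 0)"
      using s0(3,4) by simp_all
    moreover have "\<forall>i\<in>{1,2}. admissible_stationary_downstream (L i) (U i) (Us i)"
      "\<forall>i\<in>{1,2}. admissible_interior_downstream (L i) (Us i) (Us i)"
      using s1(3,4) s2(3,4) by simp_all
    ultimately have "diverge_solution L \<xi> \<alpha> U Us (\<lambda>a t. Us a) q"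
      using states sum entropy unfolding diverge_solution_def by blast
    then show "\<exists>Us Ui. diverge_solution L \<xi> \<alpha> U Us Ui q" by blast
  qed
qed

end
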